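(* Let $\Psi$ be a finite Young function, let $(\Omega,\mathcal{F},\mathbb{P})$ be an atomless probability space, and let $\rho:H^\Psi\to\mathbb{R}$ be a law-invariant convex risk measure. Put $\psi_k(x):=\Psi(k|x|)$ for $x\in\mathbb{R}$, $k\in\mathbb{N}$, and let $\mathcal{R}_\rho:\mathcal{M}_1^{(\psi_k)}\to\mathbb{R}$ be the risk functional associated with $\rho$. Then $\mathcal{R}_\rho$ is continuous with respect to the $(\psi_k)$-weak topology.
   Context: A finite Young function is a continuous nondecreasing convex function $\Psi:\mathbb{R}_+\to\mathbb{R}_+$ with $\Psi(0)=0$ and $\lim_{x\uparrow\infty}\Psi(x)=\infty$. The Orlicz heart is $H^\Psi=H^\Psi(\Omega,\mathcal{F},\mathbb{P}):=\{X\in L^0:\ \mathbb{E}[\Psi(c|X|)]<\infty\text{ for all }c>0\}$, where $L^0$ is the set of all $\mathbb{P}$-a.s. finite random variables on $(\Omega,\mathcal{F},\mathbb{P})$. A law-invariant convex risk measure on $H^\Psi$ is a map $\rho:H^\Psi\to\mathbb{R}$ satisfying: (Monotonicity) $\rho(X)\ge\rho(Y)$ for $X,Y\in H^\Psi$ with $X\le Y$ $\mathbb{P}$-a.s.; (Convexity) $\rho(\lambda X+(1-\lambda)Y)\le\lambda\rho(X)+(1-\lambda)\rho(Y)$ for $X,Y\in H^\Psi$, $\lambda\in[0,1]$; (Law-invariance) $\rho(X)=\rho(Y)$ for $X,Y\in H^\Psi$ with $\mathbb{P}\circ X^{-1}=\mathbb{P}\circ Y^{-1}$. $\mathcal{M}_1^{(\psi_k)}$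 is the set of all Borel probability measures $\mu$ on $\mathbb{R}$ with $\int\psi_k\,d\mu<\infty$ for every $k\in\mathbb{N}$; since the probability space is atomless, it equals the set $\mathcal{M}(H^\Psi)$ of distributions of all random variables in $H^\Psi$. The risk functional $\mathcal{R}_\rho:\mathcal{M}_1^{(\psi_k)}\to\mathbb{R}$ is the map determined by $\rho(X)=\mathcal{R}_\rho(\mathbb{P}\circ X^{-1})$ for all $X\in H^\Psi$. The $(\psi_k)$-weak topology on $\mathcal{M}_1^{(\psi_k)}$ is the coarsest topology for which all mappings $\mu\mapsto\int f\,d\mu$ are continuous, where $f$ ranges over all continuous $f:\mathbb{R}\to\mathbb{R}$ such that $\sup_x|f(x)/(1+\psi_k(x))|<\infty$ for some $k\in\mathbb{N}$. *)

theory Defs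
  imports "HOL-Probability.Probability"
begin

text \<open>A Young function is represented by a total function on the reals of which only the values
  on \<open>{0..}\<close> matter.\<close>

definition finite_Young_function :: "(real \<Rightarrow> real) \<Rightarrow> bool" where
  "finite_Young_function \<Psi> \<longleftrightarrow>
     \<Psi> \<in> {0..} \<rightarrow> {0..} \<and> continuous_on {0..} \<Psi> \<and> mono_on {0..} \<Psi> \<and>
     convex_on {0..} \<Psi> \<and> \<Psi> 0 = 0 \<and> filterlim \<Psi> at_top at_top"

definition atomless :: "'a measure \<Rightarrow> bool" where
  "atomless M \<longleftrightarrow> (\<forall>A\<in>sets M. emeasure M A > 0 \<longrightarrow>
     (\<exists>B\<in>sets M. B \<subseteq> A \<and> 0 < emeasure M B \<and> emeasure M B < emeasure M A))"

text \<open>Random variables are real-valued functions rather than almost sure equivalence classes.\<close>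

definition Orlicz_heart :: "(real \<Rightarrow> real) \<Rightarrow> 'a measure \<Rightarrow> ('a \<Rightarrow> real) set" where
  "Orlicz_heart \<Psi> M =
     {X \<in> borel_measurable M. \<forall>c>0. (\<integral>\<^sup>+\<omega>. ennreal (\<Psi> (c * \<bar>X \<omega>\<bar>)) \<partial>M) < \<infinity>}"

text \<open>The risk measure is antitone, since \<open>X\<close> is a payoff rather than a loss.\<close>

definition law_invariant_convex_risk_measure ::
    "'a measure \<Rightarrow> ('a \<Rightarrow> real) set \<Rightarrow> (('a \<Rightarrow> real) \<Rightarrow> real) \<Rightarrow> bool" where
  "law_invariant_convex_risk_measure M H \<rho> \<longleftrightarrow>
     (\<forall>X\<in>H. \<forall>Y\<in>H. (AE \<omega> in M. X \<omega> \<le> Y \<omega>) \<longrightarrow> \<rho> X \<ge> \<rho> Y) \<and>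
     (\<forall>X\<in>H. \<forall>Y\<in>H. \<forall>t\<in>{0..1}.
        \<rho> (\<lambda>\<omega>. t * X \<omega> + (1 - t) * Y \<omega>) \<le> t * \<rho> X + (1 - t) * \<rho> Y) \<and>
     (\<forall>X\<in>H. \<forall>Y\<in>H. distr M borel X = distr M borel Y \<longrightarrow> \<rho> X = \<rho> Y)"

definition gauge_seq :: "(real \<Rightarrow> real) \<Rightarrow> nat \<Rightarrow> real \<Rightarrow> real" where
  "gauge_seq \<Psi> k x = \<Psi> (real k * \<bar>x\<bar>)"

definition prob_measures_gauged :: "(nat \<Rightarrow> real \<Rightarrow> real) \<Rightarrow> real measure set" where
  "prob_measures_gauged \<psi> =
     {\<mu>. prob_space \<mu> \<and> sets \<mu> = sets borel \<and> (\<forall>k. (\<integral>\<^sup>+x. ennreal (\<psi> k x) \<partial>\<mu>) < \<infinity>)}"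

definition gauged_test_functions :: "(nat \<Rightarrow> real \<Rightarrow> real) \<Rightarrow> (real \<Rightarrow> real) set" where
  "gauged_test_functions \<psi> =
     {f. continuous_on UNIV f \<and> (\<exists>k. bdd_above (range (\<lambda>x. \<bar>f x / (1 + \<psi> k x)\<bar>)))}"

definition gauged_weak_topology :: "(nat \<Rightarrow> real \<Rightarrow> real) \<Rightarrow> real measure topology" where
  "gauged_weak_topology \<psi> = topology_generated_by
     {{\<mu> \<in> prob_measures_gauged \<psi>. (\<integral>x. f x \<partial>\<mu>) \<in> U} | f U.
        f \<in> gauged_test_functions \<psi> \<and> open U}"

lemma topspace_gauged_weak_topology [simp]:
  "topspace (gauged_weak_topology \<psi>) = prob_measures_gauged \<psi>"
proof -
  have "(\<lambda>_. 0) \<in> gauged_test_functions \<psi>"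
    by (auto simp: gauged_test_functions_def)
  then have "{\<mu> \<in> prob_measures_gauged \<psi>. (\<integral>x. (0::real) \<partial>\<mu>) \<in> UNIV} \<in>
      {{\<mu> \<in> prob_measures_gauged \<psi>. (\<integral>x. f x \<partial>\<mu>) \<in> U} | f U.
        f \<in> gauged_test_functions \<psi> \<and> open U}"
    by (intro CollectI exI[of _ "\<lambda>_. 0"] exI[of _ UNIV]) auto
  then show ?thesis
    unfolding gauged_weak_topology_def topology_generated_by_topspace by auto
qed

end

theory Submission
  imports Defs
begin

text \<open>On an atomless space all laws can be realised simultaneously as quantile functions of one uniform
  random variable. Along a sequence that converges on \<open>(\<psi>\<^sub>k)\<close> and on the piecewise linear steps with
  rational nodes, these quantiles converge almost surely, and by Fatou's lemma and convexity of \<open>\<Psi>\<close> all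
  integrals \<open>\<Psi>(k\<bar>X\<^sub>n - X\<bar>)\<close> tend to zero. Hence some members of the sequence satisfy
  \<open>\<bar>X\<^sub>n - X\<bar> \<le> 2\<^sup>-\<^sup>j Z\<close> with \<open>Z\<close> in the Orlicz heart, and antitonicity and convexity give
  \<open>\<bar>\<rho>(X\<^sub>n) - \<rho>(X)\<bar> \<le> 2\<^sup>-\<^sup>j (\<rho>(X - Z) - \<rho>(X))\<close>. As only countably many test functions are
  involved, sequences suffice for continuity.\<close>

subsection \<open>Uniform random variables on atomless spaces\<close>

text \<open>Such a family is a chain under inclusion on which the measure is injective, since
  members of equal measure contain each other. A member can therefore be indexed by its
  measure.\<close>

definition (in finite_measure) monotone_family :: "'a set set \<Rightarrow> bool" where
  "monotone_family C \<longleftrightarrow>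
     C \<subseteq> sets M \<and> (\<forall>A\<in>C. \<forall>B\<in>C. measure M A \<le> measure M B \<longrightarrow> A \<subseteq> B)"

text \<open>If the supremum of the measures is attained, the union is the largest member. Otherwise
  members whose measures approach the supremum absorb all others, so even an uncountable union
  reduces to a countable one and continuity from below applies.\<close>

lemma (in finite_measure) monotone_family_Union:
  assumes L: "monotone_family L" and le: "\<And>A. A \<in> L \<Longrightarrow> measure M A \<le> t" and "0 \<le> t"
  shows "\<Union>L \<in> sets M" "measure M (\<Union>L) \<le> t"
proof -
  have *: "\<Union>L \<in> sets M \<and> measure M (\<Union>L) \<le> t"
  proof (cases "\<exists>D\<in>L. \<forall>A\<in>L. measure M A \<le> measure M D")
    case True
    then obtain D where D: "D \<in> L" "\<And>A. A \<in> L \<Longrightarrow> measure M A \<le> measure M D" by blast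
    then have "\<Union>L = D" using L unfolding monotone_family_def by blast
    then show ?thesis using D L le by (auto simp: monotone_family_def)
  next
    case no_max: False
    show ?thesis
    proof (cases "L = {}")
      case True then show ?thesis using \<open>0 \<le> t\<close> by simp
    next
      case False
      define s where "s = Sup (measure M ` L)"
      have bdd: "bdd_above (measure M ` L)" using le by (auto simp: bdd_above_def)
      have "measure M A < s" if A: "A \<in> L" for A
      proof -
        obtain B where "B \<in> L" "measure M A < measure M B" using no_max A by force
        moreover have "measure M B \<le> s" unfolding s_def using \<open>B \<in> L\<close> bdd by (auto intro: cSup_upper)
        ultimately show ?thesis by simp
      qed note less = this
      have "\<exists>D\<in>L. s - 1 / real (Suc n) < measure M D" for n
        using less_cSup_iff[of "measure M ` L" "s - 1 / real (Suc n)"] bdd False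
        by (auto simp: s_def[symmetric])
      then obtain D where D: "\<And>n. D n \<in> L" "\<And>n. s - 1 / real (Suc n) < measure M (D n)" by metis
      have sub: "A \<subseteq> B" if "A \<in> L" "B \<in> L" "measure M A \<le> measure M B" for A B
        using L that by (auto simp: monotone_family_def)
      have "\<Union>L \<subseteq> (\<Union>n. D n)"
      proof
        fix x assume "x \<in> \<Union>L"
        then obtain A where A: "A \<in> L" "x \<in> A" by blast
        obtain n where "1 / real (Suc n) < s - measure M A"
          using less[OF A(1)] nat_approx_posE[of "s - measure M A"] by auto
        with D(2)[of n] have "measure M A \<le> measure M (D n)" by linarith
        then show "x \<in> (\<Union>n. D n)" using sub[OF A(1) D(1)] A by blast
      qed
      then have eq: "\<Union>L = (\<Union>n. D n)" using D by blast
      \<comment> \<open>The sets \<open>D n\<close> need not increase. Their partial unions do, and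
        they remain in the chain \<open>L\<close>, so the bound \<open>t\<close> applies to
        them.\<close>
      define E where "E n = (\<Union>i\<le>n. D i)" for n
      have E: "E n \<in> L" for n
      proof (induction n)
        case 0 then show ?case by (simp add: E_def D)
      next
        case (Suc n)
        have "E (Suc n) = E n \<union> D (Suc n)" by (auto simp: E_def atMost_Suc)
        moreover have "E n \<subseteq> D (Suc n) \<or> D (Suc n) \<subseteq> E n"
          using sub[OF Suc D(1)] sub[OF D(1) Suc] by (meson linear)
        ultimately show ?case using Suc D(1) by (metis sup.absorb1 sup.absorb2)
      qed
      have Em: "E n \<in> sets M" for n using E L by (auto simp: monotone_family_def)
      have inc: "incseq E" by (force simp: E_def incseq_def)
      have UE: "(\<Union>n. E n) = \<Union>L" unfolding eq E_def by blast
      have "(\<lambda>n. measure M (E n)) \<longlonglongrightarrow> measure M (\<Union>n. E n)"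
        using Em inc by (intro finite_Lim_measure_incseq) auto
      then have "measure M (\<Union>n. E n) \<le> t" by (rule LIMSEQ_le_const2) (use le E in auto)
      then show ?thesis using Em UE by (metis sets.countable_UN image_subset_iff)
    qed
  qed
  show "\<Union>L \<in> sets M" "measure M (\<Union>L) \<le> t" using * by auto
qed

lemma (in finite_measure) atomless_between:
  assumes "atomless M" and A: "A \<in> sets M" and B: "B \<in> sets M" and "A \<subseteq> B" "measure M A < measure M B"
  obtains C where "C \<in> sets M" "A \<subseteq> C" "C \<subseteq> B" "measure M A < measure M C" "measure M C < measure M B"
proof -
  have "measure M (B - A) > 0" using assms by (simp add: finite_measure_Diff)
  then obtain E where E: "E \<in> sets M" "E \<subseteq> B - A" "0 < emeasure M E" "emeasure M E < emeasure M (B - A)"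
    using assms(1) A B unfolding atomless_def by (metis sets.Diff emeasure_eq_measure ennreal_less_zero_iff)
  then have E': "0 < measure M E" "measure M E < measure M (B - A)"
    by (auto simp: emeasure_eq_measure ennreal_less_iff)
  have "measure M (A \<union> E) = measure M A + measure M E" using E A by (intro finite_measure_Union) auto
  then show ?thesis
    using that[of "A \<union> E"] E E' assms by (auto simp: finite_measure_Diff)
qed

text \<open>Complements reverse both the inclusions and the order of the probabilities. This lets
  intersections of members be handled by the lemma on unions.\<close>

lemma (in prob_space) monotone_family_complements:
  assumes "monotone_family C"
  shows "monotone_family ((-) (space M) ` C)"
  unfolding monotone_family_def
proof (intro conjI ballI impI)
  show "(-) (space M) ` C \<subseteq> sets M" using assms by (auto simp: monotone_family_def)
  fix A' B' assume "A' \<in> (-) (space M) ` C" "B' \<in> (-) (space M) ` C" "prob A' \<le> prob B'"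
  then obtain A B where AB: "A \<in> C" "B \<in> C" "A' = space M - A" "B' = space M - B" by auto
  then have "prob B \<le> prob A"
    using assms \<open>prob A' \<le> prob B'\<close> by (auto simp: monotone_family_def prob_compl subset_iff)
  then have "B \<subseteq> A" using AB assms by (auto simp: monotone_family_def)
  then show "A' \<subseteq> B'" using AB by auto
qed

text \<open>A maximal monotone family takes every value: at a missing value, atomlessness would provide
  a set to be added.\<close>

lemma (in prob_space) atomless_monotone_family:
  assumes atomless: "atomless M"
  obtains C where "monotone_family C" "prob ` C = {0..1}"
proof -
  have "\<exists>C\<in>Collect monotone_family. \<forall>X\<in>Collect monotone_family. C \<subseteq> X \<longrightarrow> X = C"
  proof (rule subset_Zorn')
    fix K assume K: "subset.chain (Collect monotone_family) K"
    have "A \<subseteq> B" if AB: "A \<in> \<Union>K" "B \<in> \<Union>K" "prob A \<le> prob B" for A B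
    proof -
      obtain C D where CD: "C \<in> K" "A \<in> C" "D \<in> K" "B \<in> D" using AB by blast
      then have "C \<subseteq> D \<or> D \<subseteq> C" using K by (auto simp: subset.chain_def)
      then obtain E where "E \<in> K" "A \<in> E" "B \<in> E" using CD by blast
      moreover have "monotone_family E" using K \<open>E \<in> K\<close> by (auto simp: subset.chain_def)
      ultimately show ?thesis using AB(3) by (auto simp: monotone_family_def)
    qed
    moreover have "\<Union>K \<subseteq> events" using K unfolding subset.chain_def monotone_family_def by blast
    ultimately show "\<Union>K \<in> Collect monotone_family" by (auto simp: monotone_family_def)
  qed
  then obtain C where C: "monotone_family C" and max: "\<And>X. monotone_family X \<Longrightarrow> C \<subseteq> X \<Longrightarrow> X = C" by auto
  have meas: "A \<in> events" if "A \<in> C" for A using C that by (auto simp: monotone_family_def)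
  have "t \<in> prob ` C" if t: "t \<in> {0..1}" for t
  proof (rule ccontr)
    assume nt: "t \<notin> prob ` C"
    define L where "L = {A\<in>C. prob A < t}"
    define U where "U = {A\<in>C. prob A > t}"
    define A where "A = \<Union>L"
    \<comment> \<open>This is the intersection of \<open>U\<close>, written with complements so that
      it is \<open>space M\<close> when \<open>U\<close> is empty.\<close>
    define B where "B = space M - \<Union>((-) (space M) ` U)"
    have LU: "C = L \<union> U" using nt by (force simp: L_def U_def)
    have mL: "monotone_family L" and mU: "monotone_family U"
      using C by (auto simp: monotone_family_def L_def U_def)
    have A: "A \<in> events" "prob A \<le> t"
      unfolding A_def by (rule monotone_family_Union[OF mL]; use t in \<open>auto simp: L_def\<close>)+
    have "prob D \<le> 1 - t" if "D \<in> (-) (space M) ` U" for D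
      using that meas by (auto simp: U_def prob_compl)
    then have B': "\<Union>((-) (space M) ` U) \<in> events" "prob (\<Union>((-) (space M) ` U)) \<le> 1 - t"
      using monotone_family_Union[OF monotone_family_complements[OF mU], of "1 - t"] t by auto
    then have B: "B \<in> events" "t \<le> prob B" unfolding B_def by (auto simp: prob_compl)
    have LA: "D \<subseteq> A" if "D \<in> L" for D using that by (auto simp: A_def)
    have BU: "B \<subseteq> D" if "D \<in> U" for D using that by (auto simp: B_def)
    have AB: "A \<subseteq> B"
    proof -
      have "D \<subseteq> E" if "D \<in> L" "E \<in> U" for D E
        using that C by (auto simp: L_def U_def monotone_family_def subset_iff)
      moreover have "D \<subseteq> space M" if "D \<in> L" for D
        using that meas sets.sets_into_space by (auto simp: L_def)
      ultimately show ?thesis unfolding A_def B_def by blast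
    qed
    \<comment> \<open>If \<open>A\<close> or \<open>B\<close> has probability exactly
      \<open>t\<close>, it fills the gap itself. Otherwise \<open>prob A < t < prob B\<close>, and
      atomlessness provides a set strictly between. The strict inequalities make \<open>E\<close>
      fit into the chain and differ from all its members.\<close>
    obtain E where E: "E \<in> events" "A \<subseteq> E" "E \<subseteq> B"
      "\<And>D. D \<in> L \<Longrightarrow> prob D < prob E" "\<And>D. D \<in> U \<Longrightarrow> prob E < prob D"
    proof (cases "prob A = t \<or> prob B = t")
      case True
      then show ?thesis
        using that[of A] that[of B] A B AB by (auto simp: L_def U_def)
    next
      case False
      then have "prob A < prob B" using A B by linarith
      then obtain E where E: "E \<in> events" "A \<subseteq> E" "E \<subseteq> B" "prob A < prob E" "prob E < prob B"
        using atomless_between[OF atomless A(1) B(1) AB] by blast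
      have "prob D \<le> prob A" if "D \<in> L" for D by (rule finite_measure_mono[OF LA[OF that] A(1)])
      moreover have "prob B \<le> prob D" if "D \<in> U" for D
        by (rule finite_measure_mono[OF BU[OF that]]) (use that meas in \<open>auto simp: U_def\<close>)
      ultimately show ?thesis using that[OF E(1-3)] E(4,5) by (meson le_less_trans less_le_trans)
    qed
    have "monotone_family (insert E C)"
      unfolding monotone_family_def
    proof (intro conjI ballI impI)
      show "insert E C \<subseteq> events" using E(1) meas by auto
      fix X Y assume XY: "X \<in> insert E C" "Y \<in> insert E C" "prob X \<le> prob Y"
      consider "X = E" "Y = E" | "X = E" "Y \<in> C" | "X \<in> C" "Y = E" | "X \<in> C" "Y \<in> C" using XY by blast
      then show "X \<subseteq> Y"
      proof cases
        case 2
        then have "Y \<in> U" using E(4)[of Y] XY(3) LU by force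
        then show ?thesis using BU E(3) 2 by blast
      next
        case 3
        then have "X \<in> L" using E(5)[of X] XY(3) LU by force
        then show ?thesis using LA E(2) 3 by blast
      qed (use C XY in \<open>auto simp: monotone_family_def\<close>)
    qed
    then have "E \<in> C" using max by blast
    then show False using E(4,5)[of E] LU by blast
  qed
  then have "prob ` C = {0..1}" using measure_nonneg by auto
  then show ?thesis using that C by blast
qed

text \<open>A monotone family taking all values supplies the sublevel sets: the variable sends a
  point to the least level whose set contains it. Values outside the open unit interval are removed
  at the end, so that quantile functions are only evaluated inside it.\<close>

lemma (in prob_space) atomless_uniform:
  assumes "atomless M"
  obtains U where "U \<in> borel_measurable M" "\<And>\<omega>. 0 < U \<omega> \<and> U \<omega> < 1"
    "\<And>x. x \<in> {0..1} \<Longrightarrow> prob {\<omega>\<in>space M. U \<omega> \<le> x} = x"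
proof -
  obtain C where C: "monotone_family C" "prob ` C = {0..1}" using atomless_monotone_family[OF assms] .
  then have "\<forall>t\<in>{0..1}. \<exists>A\<in>C. prob A = t" by (metis imageE)
  then obtain S where S: "\<And>t. t \<in> {0..1} \<Longrightarrow> S t \<in> C" "\<And>t. t \<in> {0..1} \<Longrightarrow> prob (S t) = t" by metis
  have S_meas: "S t \<in> events" if "t \<in> {0..1}" for t using S(1)[OF that] C(1) by (auto simp: monotone_family_def)
  have S_mono: "S s \<subseteq> S t" if "s \<in> {0..1}" "t \<in> {0..1}" "s \<le> t" for s t
    using S(1)[OF that(1)] S(1)[OF that(2)] S(2)[OF that(1)] S(2)[OF that(2)] that(3) C(1)
    by (auto simp: monotone_family_def)
  \<comment> \<open>A point may lie in none of the sets, as even \<open>S 1\<close> is only known to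
    have probability 1. The extra level 1 keeps the infimum over a nonempty set.\<close>
  define T where "T \<omega> = insert 1 {t\<in>{0..1}. \<omega> \<in> S t}" for \<omega>
  define U where "U \<omega> = Inf (T \<omega>)" for \<omega>
  have T: "T \<omega> \<noteq> {}" "bdd_below (T \<omega>)" for \<omega>
    by (auto simp: T_def bdd_below_def intro!: exI[of _ 0])
  \<comment> \<open>Rational levels turn a strict sublevel set into a countable union, which gives
    measurability.\<close>
  have U_less: "U \<omega> < x \<longleftrightarrow> (\<exists>t\<in>{0..1} \<inter> \<rat> \<inter> {..<x}. \<omega> \<in> S t)" if "x \<le> 1" for x \<omega>
  proof
    assume "U \<omega> < x"
    then obtain t where "t \<in> T \<omega>" "t < x" unfolding U_def using T cInf_less_iff by blast
    then have t: "t \<in> {0..1}" "\<omega> \<in> S t" "t < x" using that by (auto simp: T_def)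
    then obtain q where "q \<in> \<rat>" "t < q" "q < x" using Rats_dense_in_real by blast
    then show "\<exists>t\<in>{0..1} \<inter> \<rat> \<inter> {..<x}. \<omega> \<in> S t" using t that S_mono[of t q] by (intro bexI[of _ q]) auto
  next
    assume "\<exists>t\<in>{0..1} \<inter> \<rat> \<inter> {..<x}. \<omega> \<in> S t"
    then have "\<exists>t\<in>T \<omega>. t < x" by (auto simp: T_def)
    then show "U \<omega> < x" unfolding U_def using T cInf_less_iff by blast
  qed
  have U01: "0 \<le> U \<omega>" "U \<omega> \<le> 1" for \<omega>
    unfolding U_def by (rule cInf_greatest[OF T(1)]; force simp: T_def) (rule cInf_lower[OF _ T(2)]; simp add: T_def)
  have U_meas[measurable]: "U \<in> borel_measurable M"
  proof (rule borel_measurableI_less)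
    fix x
    show "{\<omega>\<in>space M. U \<omega> < x} \<in> events"
    proof (cases "x \<le> 1")
      case True
      have "(\<Union>t\<in>{0..1} \<inter> \<rat> \<inter> {..<x}. S t) \<in> events"
        using S_meas countable_rat by (intro sets.countable_UN') (auto intro: countable_subset)
      moreover have "{\<omega>\<in>space M. U \<omega> < x} = space M \<inter> (\<Union>t\<in>{0..1} \<inter> \<rat> \<inter> {..<x}. S t)"
        using U_less[OF True] by auto
      ultimately show ?thesis by auto
    next
      case False
      then have "{\<omega>\<in>space M. U \<omega> < x} = space M" using le_less_trans[OF U01(2)] by auto
      then show ?thesis by simp
    qed
  qed
  have S_le: "S t \<subseteq> {\<omega>\<in>space M. U \<omega> \<le> t}" if "t \<in> {0..1}" for t
  proof
    fix \<omega> assume "\<omega> \<in> S t"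
    then have "t \<in> T \<omega>" "\<omega> \<in> space M" using that S_meas sets.sets_into_space by (auto simp: T_def)
    then show "\<omega> \<in> {\<omega>\<in>space M. U \<omega> \<le> t}" using cInf_lower[OF _ T(2)] by (simp add: U_def)
  qed
  have lower: "x \<le> prob {\<omega>\<in>space M. U \<omega> \<le> x}" if x: "x \<in> {0..1}" for x
    using finite_measure_mono[OF S_le[OF x]] S(2)[OF x] by simp
  have cdf: "prob {\<omega>\<in>space M. U \<omega> \<le> x} = x" if x: "x \<in> {0..1}" for x
  proof (cases "x = 1")
    case True
    then show ?thesis using lower[OF x] by (intro antisym) auto
  next
    case False
    \<comment> \<open>The infimum need not be attained, so the sublevel set at \<open>x\<close> is
      enclosed only in \<open>S y\<close> for \<open>y\<close> above \<open>x\<close>. Letting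
      \<open>y\<close> decrease to \<open>x\<close> closes the gap.\<close>
    have "prob {\<omega>\<in>space M. U \<omega> \<le> x} \<le> y" if y: "x < y" "y < 1" for y
    proof -
      have "{\<omega>\<in>space M. U \<omega> \<le> x} \<subseteq> S y"
      proof clarsimp
        fix \<omega> assume "U \<omega> \<le> x"
        then obtain t where "t \<in> {0..1}" "t < y" "\<omega> \<in> S t" using U_less[of y \<omega>] y by auto
        then show "\<omega> \<in> S y" using S_mono[of t y] x y by auto
      qed
      then show ?thesis using finite_measure_mono[OF _ S_meas[of y]] S(2)[of y] x y by force
    qed
    then have "prob {\<omega>\<in>space M. U \<omega> \<le> x} \<le> x"
      using False x by (intro dense_ge_bounded[of x 1]) auto
    then show ?thesis using lower[OF x] by simp
  qed
  have AE0: "AE \<omega> in M. 0 < U \<omega>"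
    using cdf[of 0] by (subst AE_iff_measurable[OF _ refl]) (auto simp: emeasure_eq_measure not_less)
  have AE1: "AE \<omega> in M. U \<omega> < 1"
  proof -
    have "prob {\<omega>\<in>space M. \<not> U \<omega> < 1} \<le> e" if "0 < e" "e < 1" for e
    proof -
      have "prob {\<omega>\<in>space M. \<not> U \<omega> < 1} \<le> prob (space M - {\<omega>\<in>space M. U \<omega> \<le> 1 - e})"
        using that by (intro finite_measure_mono) auto
      also have "\<dots> = e" using cdf[of "1 - e"] that by (subst prob_compl) auto
      finally show ?thesis .
    qed
    then have "prob {\<omega>\<in>space M. \<not> U \<omega> < 1} \<le> 0" by (intro dense_ge_bounded[of 0 1]) auto
    then show ?thesis
      by (subst AE_iff_measurable[OF _ refl]) (auto simp: emeasure_eq_measure ennreal_eq_0_iff)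
  qed
  \<comment> \<open>The value 1/2 is an arbitrary interior default. It is taken on a null set only,
    so the distribution is unchanged.\<close>
  define V where "V \<omega> = (if 0 < U \<omega> \<and> U \<omega> < 1 then U \<omega> else 1 / 2)" for \<omega>
  have V_meas[measurable]: "V \<in> borel_measurable M" unfolding V_def by measurable
  have "prob {\<omega>\<in>space M. V \<omega> \<le> x} = prob {\<omega>\<in>space M. U \<omega> \<le> x}" for x
    by (rule finite_measure_eq_AE) (use AE0 AE1 in \<open>auto simp: V_def\<close>)
  then show ?thesis using that[OF V_meas] cdf by (auto simp: V_def)
qed

subsection \<open>Quantile functions\<close>

text \<open>This is the left-continuous generalised inverse of the distribution function. It is
  meaningful for \<open>u\<close> strictly between 0 and 1, where the set is nonempty and bounded
  below.\<close>

definition quantile :: "real measure \<Rightarrow> real \<Rightarrow> real" where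
  "quantile \<mu> u = Inf {x. u \<le> cdf \<mu> x}"

text \<open>The infimum is attained by right-continuity of the distribution function. Later
  arguments about quantile values use this Galois connection in place of the infimum.\<close>

lemma (in real_distribution) quantile_le_iff:
  assumes "0 < u" "u < 1"
  shows "quantile M u \<le> x \<longleftrightarrow> u \<le> cdf M x"
proof -
  interpret cdf_distribution M by unfold_locales
  show ?thesis unfolding quantile_def by (rule pseudoinverse[OF assms, symmetric])
qed

lemma (in real_distribution) mono_on_quantile: "mono_on {0<..<1} (quantile M)"
proof -
  interpret cdf_distribution M by unfold_locales
  show ?thesis unfolding quantile_def by (rule mono_I)
qed

text \<open>By the Galois connection a sublevel set of the composed variable is a sublevel set of
  \<open>U\<close> at level \<open>cdf \<mu> x\<close>. This yields measurability and the
  distribution function at once.\<close>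

lemma (in prob_space) distr_quantile:
  assumes U: "U \<in> borel_measurable M" "\<And>\<omega>. 0 < U \<omega> \<and> U \<omega> < 1"
      "\<And>x. x \<in> {0..1} \<Longrightarrow> prob {\<omega>\<in>space M. U \<omega> \<le> x} = x"
    and \<mu>: "real_distribution \<mu>"
  shows "(\<lambda>\<omega>. quantile \<mu> (U \<omega>)) \<in> borel_measurable M"
    "distr M borel (\<lambda>\<omega>. quantile \<mu> (U \<omega>)) = \<mu>"
proof -
  interpret \<mu>: real_distribution \<mu> by fact
  note [measurable] = U(1)
  have eq: "quantile \<mu> (U \<omega>) \<le> x \<longleftrightarrow> U \<omega> \<le> cdf \<mu> x" for \<omega> x
    using \<mu>.quantile_le_iff U(2) by blast
  show meas[measurable]: "(\<lambda>\<omega>. quantile \<mu> (U \<omega>)) \<in> borel_measurable M"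
    unfolding borel_measurable_iff_le eq by measurable
  show "distr M borel (\<lambda>\<omega>. quantile \<mu> (U \<omega>)) = \<mu>"
  proof (rule cdf_unique)
    show "cdf (distr M borel (\<lambda>\<omega>. quantile \<mu> (U \<omega>))) = cdf \<mu>"
    proof
      fix x
      have "cdf (distr M borel (\<lambda>\<omega>. quantile \<mu> (U \<omega>))) x = prob {\<omega>\<in>space M. quantile \<mu> (U \<omega>) \<le> x}"
        by (subst cdf_def, subst measure_distr) (auto intro!: arg_cong[where f=prob])
      also have "\<dots> = cdf \<mu> x"
        unfolding eq by (rule U(3)) (use \<mu>.cdf_nonneg \<mu>.cdf_bounded_prob in auto)
      finally show "cdf (distr M borel (\<lambda>\<omega>. quantile \<mu> (U \<omega>))) x = cdf \<mu> x" .
    qed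
  qed (use \<mu> in auto)
qed

text \<open>The integral of \<open>cts_step q r\<close> lies between the values of the distribution
  function at \<open>q\<close> and at \<open>r\<close>. Convergence of these integrals thus
  transfers strict bounds from the limit law to the approximating laws, at the price of moving
  between nearby rationals.\<close>

lemma quantile_tendsto:
  assumes \<nu>: "\<And>n. real_distribution (\<nu> n)" and \<mu>: "real_distribution \<mu>"
    and conv: "\<And>q r. q \<in> \<rat> \<Longrightarrow> r \<in> \<rat> \<Longrightarrow> q < r \<Longrightarrow>
      (\<lambda>n. \<integral>x. cts_step q r x \<partial>\<nu> n) \<longlonglongrightarrow> (\<integral>x. cts_step q r x \<partial>\<mu>)"
    and u: "0 < u" "u < 1" and cont: "isCont (quantile \<mu>) u"
  shows "(\<lambda>n. quantile (\<nu> n) u) \<longlonglongrightarrow> quantile \<mu> u"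
proof (rule order_tendstoI)
  interpret \<mu>: real_distribution \<mu> by fact
  fix a assume "a < quantile \<mu> u"
  then obtain r where r: "r \<in> \<rat>" "a < r" "r < quantile \<mu> u" using Rats_dense_in_real by blast
  then obtain q where q: "q \<in> \<rat>" "a < q" "q < r" using Rats_dense_in_real by blast
  have "(\<integral>x. cts_step q r x \<partial>\<mu>) \<le> cdf \<mu> r" by (rule \<mu>.cdf_cts_step) fact
  also have "\<dots> < u" using r \<mu>.quantile_le_iff[OF u, of r] by auto
  finally have "\<forall>\<^sub>F n in sequentially. (\<integral>x. cts_step q r x \<partial>\<nu> n) < u"
    using order_tendstoD(2)[OF conv[OF q(1) r(1) q(3)]] by blast
  then show "\<forall>\<^sub>F n in sequentially. a < quantile (\<nu> n) u"
  proof eventually_elim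
    case (elim n)
    then have "cdf (\<nu> n) q < u"
      using real_distribution.cdf_cts_step(1)[OF \<nu> q(3), of n] by simp
    then have "q < quantile (\<nu> n) u"
      using real_distribution.quantile_le_iff[OF \<nu> u, of n q] by auto
    then show ?case using q by simp
  qed
next
  interpret \<mu>: real_distribution \<mu> by fact
  fix b assume b: "quantile \<mu> u < b"
  \<comment> \<open>At \<open>u\<close> itself the Galois connection gives only the weak bound
    \<open>u \<le> cdf \<mu> q\<close>. Continuity provides \<open>v > u\<close> with quantile still
    below \<open>b\<close>, which makes the bound strict.\<close>
  have "(quantile \<mu> \<longlongrightarrow> quantile \<mu> u) (at_right u)"
    using cont by (auto simp: isCont_def intro: tendsto_within_subset)
  then have "\<forall>\<^sub>F v in at_right u. quantile \<mu> v < b" using b by (rule order_tendstoD)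
  moreover have "\<forall>\<^sub>F v in at_right u. u < v \<and> v < 1"
    using u by (auto simp: eventually_at_right[of u 1])
  ultimately have "\<forall>\<^sub>F v in at_right u. quantile \<mu> v < b \<and> u < v \<and> v < 1" by eventually_elim auto
  then obtain v where v: "quantile \<mu> v < b" "u < v" "v < 1"
    using eventually_happens'[OF trivial_limit_at_right_real] by blast
  then obtain q where q: "q \<in> \<rat>" "quantile \<mu> v < q" "q < b" using Rats_dense_in_real by blast
  then obtain r where r: "r \<in> \<rat>" "q < r" "r < b" using Rats_dense_in_real by blast
  have "v \<le> cdf \<mu> q" using \<mu>.quantile_le_iff[of v q] v u q by auto
  also have "\<dots> \<le> (\<integral>x. cts_step q r x \<partial>\<mu>)" by (rule \<mu>.cdf_cts_step) fact
  finally have "u < (\<integral>x. cts_step q r x \<partial>\<mu>)" using v by simp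
  then have "\<forall>\<^sub>F n in sequentially. u < (\<integral>x. cts_step q r x \<partial>\<nu> n)"
    using order_tendstoD(1)[OF conv[OF q(1) r(1,2)]] by blast
  then show "\<forall>\<^sub>F n in sequentially. quantile (\<nu> n) u < b"
  proof eventually_elim
    case (elim n)
    then have "u \<le> cdf (\<nu> n) r"
      using real_distribution.cdf_cts_step(2)[OF \<nu> r(2), of n] by simp
    then show ?case using real_distribution.quantile_le_iff[OF \<nu> u, of n r] r by auto
  qed
qed

text \<open>A monotone function has countably many discontinuities, and a uniform variable hits a
  countable set with probability zero.\<close>

lemma (in prob_space) AE_quantile_tendsto:
  assumes U: "U \<in> borel_measurable M" "\<And>\<omega>. 0 < U \<omega> \<and> U \<omega> < 1"
      "\<And>x. x \<in> {0..1} \<Longrightarrow> prob {\<omega>\<in>space M. U \<omega> \<le> x} = x"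
    and \<nu>: "\<And>n. real_distribution (\<nu> n)" and \<mu>: "real_distribution \<mu>"
    and conv: "\<And>q r. q \<in> \<rat> \<Longrightarrow> r \<in> \<rat> \<Longrightarrow> q < r \<Longrightarrow>
      (\<lambda>n. \<integral>x. cts_step q r x \<partial>\<nu> n) \<longlonglongrightarrow> (\<integral>x. cts_step q r x \<partial>\<mu>)"
  shows "AE \<omega> in M. (\<lambda>n. quantile (\<nu> n) (U \<omega>)) \<longlonglongrightarrow> quantile \<mu> (U \<omega>)"
proof -
  note [measurable] = U(1)
  let ?D = "{u\<in>{0<..<1}. \<not> isCont (quantile \<mu>) u}"
  have "countable ?D"
    using mono_on_ctble_discont[OF real_distribution.mono_on_quantile[OF \<mu>]]
    by (simp add: at_within_open[of _ "{0<..<1}"] cong: conj_cong)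
  moreover have "AE \<omega> in M. U \<omega> \<noteq> u" if u: "u \<in> ?D" for u
  proof -
    have "prob {\<omega>\<in>space M. U \<omega> = u} \<le> e" if "0 < e" "e < u" for e
    proof -
      have "prob {\<omega>\<in>space M. U \<omega> = u} \<le> prob ({\<omega>\<in>space M. U \<omega> \<le> u} - {\<omega>\<in>space M. U \<omega> \<le> u - e})"
        using that by (intro finite_measure_mono) auto
      also have "\<dots> = e" using U(3)[of u] U(3)[of "u - e"] that u
        by (subst finite_measure_Diff) auto
      finally show ?thesis .
    qed
    then have "prob {\<omega>\<in>space M. U \<omega> = u} \<le> 0" using u by (intro dense_ge_bounded[of 0 u]) auto
    then show ?thesis by (subst AE_iff_measurable[OF _ refl]) (auto simp: emeasure_eq_measure ennreal_eq_0_iff)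
  qed
  ultimately have "AE \<omega> in M. \<forall>u\<in>?D. U \<omega> \<noteq> u" by (subst AE_ball_countable) auto
  then show ?thesis
  proof eventually_elim
    case (elim \<omega>)
    then have "isCont (quantile \<mu>) (U \<omega>)" using U(2) by auto
    then show ?case using U(2)[of \<omega>] by (intro quantile_tendsto[OF \<nu> \<mu> conv]) auto
  qed
qed

subsection \<open>Orlicz hearts\<close>

lemma le_suminf_ennreal: "f j \<le> (\<Sum>i. f i :: ennreal)"
  using sum_le_suminf[of f "{j}"] by auto

context
  fixes \<Psi> :: "real \<Rightarrow> real"
  assumes young: "finite_Young_function \<Psi>"
begin

section \<open>Inequalities and continuity for Young functions\<close>

lemma Young_nonneg: "0 \<le> x \<Longrightarrow> 0 \<le> \<Psi> x"
  using young by (auto simp: finite_Young_function_def)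

lemma Young_mono: "0 \<le> x \<Longrightarrow> x \<le> y \<Longrightarrow> \<Psi> x \<le> \<Psi> y"
  using young by (auto simp: finite_Young_function_def mono_on_def)

text \<open>After the triangle inequality, the sum is the midpoint of the doubled summands, so
  convexity applies. The doubled constant is harmless because the Orlicz heart admits every
  constant.\<close>

lemma Young_midpoint:
  assumes "0 \<le> c"
  shows "\<Psi> (c * \<bar>x + y\<bar>) \<le> (\<Psi> (2 * c * \<bar>x\<bar>) + \<Psi> (2 * c * \<bar>y\<bar>)) / 2"
proof -
  have "c * \<bar>x + y\<bar> \<le> c * (\<bar>x\<bar> + \<bar>y\<bar>)" using assms by (intro mult_left_mono) auto
  then have "\<Psi> (c * \<bar>x + y\<bar>) \<le> \<Psi> (c * (\<bar>x\<bar> + \<bar>y\<bar>))" using assms by (intro Young_mono) auto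
  also have "\<dots> = \<Psi> ((1 - 1/2) *\<^sub>R (2 * c * \<bar>x\<bar>) + (1/2) *\<^sub>R (2 * c * \<bar>y\<bar>))"
    by (simp add: algebra_simps)
  also have "\<dots> \<le> (1 - 1/2) * \<Psi> (2 * c * \<bar>x\<bar>) + (1/2) * \<Psi> (2 * c * \<bar>y\<bar>)"
    using young assms by (intro convex_onD[where A = "{0..}"]) (auto simp: finite_Young_function_def)
  finally show ?thesis by simp
qed

text \<open>Nothing is known about \<open>\<Psi>\<close> at negative arguments, so regularity is
  stated for its composition with a nonnegative multiple of the absolute value.\<close>

lemma continuous_on_Young_abs:
  assumes "0 \<le> c"
  shows "continuous_on UNIV (\<lambda>x. \<Psi> (c * \<bar>x\<bar>))"
proof -
  have "continuous_on {0..} \<Psi>" using young by (auto simp: finite_Young_function_def)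
  then show ?thesis by (rule continuous_on_compose2) (use assms in \<open>auto intro!: continuous_intros\<close>)
qed

lemma measurable_Young_abs [measurable]:
  assumes [measurable]: "X \<in> borel_measurable M" and "0 \<le> c"
  shows "(\<lambda>\<omega>. \<Psi> (c * \<bar>X \<omega>\<bar>)) \<in> borel_measurable M"
  using borel_measurable_continuous_onI[OF continuous_on_Young_abs[OF assms(2)]] by measurable

lemma Young_abs_tendsto:
  assumes "X \<longlonglongrightarrow> x" and "0 \<le> c"
  shows "(\<lambda>n. \<Psi> (c * \<bar>X n\<bar>)) \<longlonglongrightarrow> \<Psi> (c * \<bar>x\<bar>)"
  using continuous_on_tendsto_compose[OF continuous_on_Young_abs[OF assms(2)] assms(1)] by simp

section \<open>Membership and closure properties of the Orlicz heart\<close>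

lemma Orlicz_heartD:
  assumes "X \<in> Orlicz_heart \<Psi> M"
  shows "X \<in> borel_measurable M"
    and "0 \<le> c \<Longrightarrow> integrable M (\<lambda>\<omega>. \<Psi> (c * \<bar>X \<omega>\<bar>))"
proof -
  show [measurable]: "X \<in> borel_measurable M" using assms by (simp add: Orlicz_heart_def)
  assume c: "0 \<le> c"
  \<comment> \<open>The definition covers positive constants only; passing to \<open>c + 1\<close>
    includes \<open>c = 0\<close>.\<close>
  have "(\<integral>\<^sup>+\<omega>. ennreal (\<Psi> (c * \<bar>X \<omega>\<bar>)) \<partial>M) \<le> (\<integral>\<^sup>+\<omega>. ennreal (\<Psi> ((c + 1) * \<bar>X \<omega>\<bar>)) \<partial>M)"
    using c by (intro nn_integral_mono ennreal_leI Young_mono) (auto simp: mult_right_mono)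
  also have "\<dots> < \<infinity>" using assms c by (simp add: Orlicz_heart_def)
  finally show "integrable M (\<lambda>\<omega>. \<Psi> (c * \<bar>X \<omega>\<bar>))"
    using c Young_nonneg by (intro integrableI_nonneg) auto
qed

text \<open>By monotonicity the integer constants dominate all others; these are the ones occurring
  in \<open>gauge_seq\<close>.\<close>

lemma Orlicz_heartI:
  assumes [measurable]: "X \<in> borel_measurable M"
    and "\<And>k::nat. (\<integral>\<^sup>+\<omega>. ennreal (\<Psi> (real k * \<bar>X \<omega>\<bar>)) \<partial>M) < \<infinity>"
  shows "X \<in> Orlicz_heart \<Psi> M"
  unfolding Orlicz_heart_def
proof (intro CollectI conjI allI impI)
  fix c :: real assume "0 < c"
  obtain k :: nat where "c \<le> real k" using real_arch_simple by blast
  then have "(\<integral>\<^sup>+\<omega>. ennreal (\<Psi> (c * \<bar>X \<omega>\<bar>)) \<partial>M) \<le> (\<integral>\<^sup>+\<omega>. ennreal (\<Psi> (real k * \<bar>X \<omega>\<bar>)) \<partial>M)"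
    using \<open>0 < c\<close> by (intro nn_integral_mono ennreal_leI Young_mono) (auto simp: mult_right_mono)
  also have "\<dots> < \<infinity>" by fact
  finally show "(\<integral>\<^sup>+\<omega>. ennreal (\<Psi> (c * \<bar>X \<omega>\<bar>)) \<partial>M) < \<infinity>" .
qed fact

lemma Orlicz_heart_add_scaled:
  assumes X: "X \<in> Orlicz_heart \<Psi> M" and Y: "Y \<in> Orlicz_heart \<Psi> M"
  shows "(\<lambda>\<omega>. X \<omega> + a * Y \<omega>) \<in> Orlicz_heart \<Psi> M"
  unfolding Orlicz_heart_def
proof (intro CollectI conjI allI impI)
  note [measurable] = Orlicz_heartD(1)[OF X] Orlicz_heartD(1)[OF Y]
  show "(\<lambda>\<omega>. X \<omega> + a * Y \<omega>) \<in> borel_measurable M" by measurable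
  fix c :: real assume c: "0 < c"
  let ?g = "\<lambda>\<omega>. (\<Psi> (2 * c * \<bar>X \<omega>\<bar>) + \<Psi> ((2 * c * \<bar>a\<bar>) * \<bar>Y \<omega>\<bar>)) / 2"
  have "integrable M (\<lambda>\<omega>. \<Psi> (2 * c * \<bar>X \<omega>\<bar>))" "integrable M (\<lambda>\<omega>. \<Psi> ((2 * c * \<bar>a\<bar>) * \<bar>Y \<omega>\<bar>))"
    using c by (intro Orlicz_heartD(2)[OF X] Orlicz_heartD(2)[OF Y]; simp)+
  then have "integrable M ?g" by (intro integrable_divide_zero Bochner_Integration.integrable_add)
  then have "integrable M (\<lambda>\<omega>. \<Psi> (c * \<bar>X \<omega> + a * Y \<omega>\<bar>))"
  proof (rule Bochner_Integration.integrable_bound)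
    show "(\<lambda>\<omega>. \<Psi> (c * \<bar>X \<omega> + a * Y \<omega>\<bar>)) \<in> borel_measurable M"
      using c by (intro measurable_Young_abs) auto
    have "norm (\<Psi> (c * \<bar>X \<omega> + a * Y \<omega>\<bar>)) \<le> norm (?g \<omega>)" for \<omega>
    proof -
      have "2 * c * \<bar>a * Y \<omega>\<bar> = (2 * c * \<bar>a\<bar>) * \<bar>Y \<omega>\<bar>" by (simp add: abs_mult)
      then have "\<Psi> (c * \<bar>X \<omega> + a * Y \<omega>\<bar>) \<le> ?g \<omega>"
        using Young_midpoint[of c "X \<omega>" "a * Y \<omega>"] c by (simp only: less_imp_le)
      moreover have "0 \<le> \<Psi> (c * \<bar>X \<omega> + a * Y \<omega>\<bar>)" using c by (intro Young_nonneg) simp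
      ultimately show ?thesis by simp
    qed
    then show "AE \<omega> in M. norm (\<Psi> (c * \<bar>X \<omega> + a * Y \<omega>\<bar>)) \<le> norm (?g \<omega>)" by simp
  qed
  then show "(\<integral>\<^sup>+\<omega>. ennreal (\<Psi> (c * \<bar>X \<omega> + a * Y \<omega>\<bar>)) \<partial>M) < \<infinity>"
    using c Young_nonneg by (subst nn_integral_eq_integral) auto
qed

section \<open>Convergence and domination in the Orlicz heart\<close>

text \<open>This is dominated convergence with varying majorants. The midpoint inequality makes
  \<open>h n\<close> nonnegative, and \<open>h n\<close> tends to \<open>g\<close> almost
  everywhere. Fatou's lemma then bounds the integrals of \<open>h n\<close> from below, while those
  of \<open>f n\<close> converge to that of \<open>g\<close>, which leaves no mass for
  \<open>d n\<close>.\<close>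

lemma Young_difference_integral_tendsto_0:
  assumes Y: "\<And>n. Y n \<in> Orlicz_heart \<Psi> M" and X: "X \<in> Orlicz_heart \<Psi> M"
    and AE: "AE \<omega> in M. (\<lambda>n. Y n \<omega>) \<longlonglongrightarrow> X \<omega>"
    and conv: "\<And>k::nat. (\<lambda>n. \<integral>\<omega>. \<Psi> (real k * \<bar>Y n \<omega>\<bar>) \<partial>M) \<longlonglongrightarrow> (\<integral>\<omega>. \<Psi> (real k * \<bar>X \<omega>\<bar>) \<partial>M)"
  shows "(\<lambda>n. \<integral>\<omega>. \<Psi> (real k * \<bar>Y n \<omega> - X \<omega>\<bar>) \<partial>M) \<longlonglongrightarrow> 0"
proof -
  define f where "f n \<omega> = \<Psi> (real (2 * k) * \<bar>Y n \<omega>\<bar>)" for n \<omega>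
  define g where "g \<omega> = \<Psi> (real (2 * k) * \<bar>X \<omega>\<bar>)" for \<omega>
  define d where "d n \<omega> = \<Psi> (real k * \<bar>Y n \<omega> - X \<omega>\<bar>)" for n \<omega>
  define h where "h n \<omega> = (f n \<omega> + g \<omega>) / 2 - d n \<omega>" for n \<omega>
  have f: "integrable M (f n)" for n unfolding f_def by (rule Orlicz_heartD[OF Y]) simp
  have g: "integrable M g" unfolding g_def by (rule Orlicz_heartD[OF X]) simp
  have d: "integrable M (d n)" for n
    using Orlicz_heartD(2)[OF Orlicz_heart_add_scaled[OF Y X, of n "- 1"], of "real k"] by (simp add: d_def[abs_def])
  have h: "integrable M (h n)" for n unfolding h_def using f g d by auto
  have d0: "0 \<le> d n \<omega>" for n \<omega> by (simp add: d_def Young_nonneg)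
  have h0: "0 \<le> h n \<omega>" for n \<omega>
    using Young_midpoint[of "real k" "Y n \<omega>" "- X \<omega>"] by (simp add: h_def f_def g_def d_def)
  have g0: "0 \<le> g \<omega>" for \<omega> by (simp add: g_def Young_nonneg)
  have "AE \<omega> in M. ennreal (g \<omega>) = liminf (\<lambda>n. ennreal (h n \<omega>))"
    using AE
  proof eventually_elim
    case (elim \<omega>)
    have "(\<lambda>n. Y n \<omega> - X \<omega>) \<longlonglongrightarrow> X \<omega> - X \<omega>" by (intro tendsto_intros elim)
    from Young_abs_tendsto[OF this, of "real k"] have "(\<lambda>n. d n \<omega>) \<longlonglongrightarrow> 0"
      using young by (simp add: d_def finite_Young_function_def)
    moreover have "(\<lambda>n. f n \<omega>) \<longlonglongrightarrow> g \<omega>" unfolding f_def g_def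
      by (intro Young_abs_tendsto elim) simp
    ultimately have "(\<lambda>n. h n \<omega>) \<longlonglongrightarrow> (g \<omega> + g \<omega>) / 2 - 0" unfolding h_def by (intro tendsto_intros) auto
    then have "(\<lambda>n. ennreal (h n \<omega>)) \<longlonglongrightarrow> ennreal (g \<omega>)" by (intro tendsto_ennrealI) simp
    then show ?case by (intro lim_imp_Liminf[symmetric]) auto
  qed
  then have "ennreal (integral\<^sup>L M g) = (\<integral>\<^sup>+\<omega>. liminf (\<lambda>n. ennreal (h n \<omega>)) \<partial>M)"
    using g g0 by (subst nn_integral_eq_integral[symmetric]) (auto intro: nn_integral_cong_AE)
  also have "\<dots> \<le> liminf (\<lambda>n. \<integral>\<^sup>+\<omega>. ennreal (h n \<omega>) \<partial>M)"
    using h by (intro nn_integral_liminf) auto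
  also have "\<dots> = liminf (\<lambda>n. ennreal (integral\<^sup>L M (h n)))"
    using h h0 by (subst nn_integral_eq_integral) auto
  finally have Fatou: "ennreal (integral\<^sup>L M g) \<le> liminf (\<lambda>n. ennreal (integral\<^sup>L M (h n)))" .
  have int_h: "integral\<^sup>L M (h n) = (integral\<^sup>L M (f n) + integral\<^sup>L M g) / 2 - integral\<^sup>L M (d n)" for n
    unfolding h_def using f g d by simp
  have int_f: "(\<lambda>n. integral\<^sup>L M (f n)) \<longlonglongrightarrow> integral\<^sup>L M g" unfolding f_def g_def by (rule conv)
  have "(\<lambda>n. integral\<^sup>L M (d n)) \<longlonglongrightarrow> 0"
  proof (rule order_tendstoI)
    fix a :: real assume "a < 0"
    then show "\<forall>\<^sub>F n in sequentially. a < integral\<^sup>L M (d n)"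
      using d0 by (intro always_eventually allI) (rule less_le_trans, auto)
  next
    fix e :: real assume e: "0 < e"
    have "\<forall>\<^sub>F n in sequentially. integral\<^sup>L M g - e / 2 < integral\<^sup>L M (h n)"
    \<comment> \<open>The case split is needed because \<open>ennreal\<close> truncates negative
      numbers to 0.\<close>
    proof (cases "integral\<^sup>L M g - e / 2 < 0")
      case True
      have "0 \<le> integral\<^sup>L M (h n)" for n using h0 by simp
      then show ?thesis using True by (intro always_eventually allI) (rule less_le_trans)
    next
      case False
      then have "ennreal (integral\<^sup>L M g - e / 2) < ennreal (integral\<^sup>L M g)"
        using e by (intro ennreal_lessI) auto
      then have "\<forall>\<^sub>F n in sequentially. ennreal (integral\<^sup>L M g - e / 2) < ennreal (integral\<^sup>L M (h n))"
        using Fatou unfolding le_Liminf_iff by blast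
      then show ?thesis
        by eventually_elim (use False in \<open>simp add: ennreal_less_iff\<close>)
    qed
    \<comment> \<open>In \<open>int_h\<close> the error \<open>e\<close> of \<open>f n\<close> is
      halved; with the error \<open>e / 2\<close> of \<open>h n\<close> the total is exactly
      \<open>e\<close>.\<close>
    moreover have "\<forall>\<^sub>F n in sequentially. integral\<^sup>L M (f n) < integral\<^sup>L M g + e"
      using e by (intro order_tendstoD(2)[OF int_f]) auto
    ultimately show "\<forall>\<^sub>F n in sequentially. integral\<^sup>L M (d n) < e"
    proof eventually_elim
      case (elim n)
      then show ?case using int_h[of n] by argo
    qed
  qed
  then show ?thesis by (simp add: d_def[abs_def])
qed

text \<open>The indices are chosen so that the integrals at constant \<open>4 ^ j\<close> are below
  a summable sequence. Of the two factors \<open>2 ^ j\<close> in \<open>4 ^ j\<close>, one is the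
  weight in the supremum defining \<open>Z\<close> and the other eventually exceeds any given
  constant \<open>c\<close>.\<close>

lemma Orlicz_heart_fast_dominated:
  assumes D: "\<And>n. D n \<in> Orlicz_heart \<Psi> M"
    and conv: "\<And>k::nat. (\<lambda>n. \<integral>\<omega>. \<Psi> (real k * \<bar>D n \<omega>\<bar>) \<partial>M) \<longlonglongrightarrow> 0"
  obtains r :: "nat \<Rightarrow> nat" and Z where "Z \<in> Orlicz_heart \<Psi> M" "AE \<omega> in M. \<forall>j. \<bar>D (r j) \<omega>\<bar> \<le> (1/2) ^ j * Z \<omega>"
proof -
  have "\<exists>n. (\<integral>\<omega>. \<Psi> (4 ^ j * \<bar>D n \<omega>\<bar>) \<partial>M) < (1/2) ^ j" for j :: nat
  proof -
    have "\<forall>\<^sub>F n in sequentially. (\<integral>\<omega>. \<Psi> (real (4 ^ j) * \<bar>D n \<omega>\<bar>) \<partial>M) < (1/2) ^ j"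
      by (rule order_tendstoD(2)[OF conv]) simp
    then show ?thesis using eventually_happens'[OF sequentially_bot] by force
  qed
  then obtain r where r: "\<And>j::nat. (\<integral>\<omega>. \<Psi> (4 ^ j * \<bar>D (r j) \<omega>\<bar>) \<partial>M) < (1/2) ^ j" by metis
  \<comment> \<open>In \<open>ennreal\<close> the supremum always exists. Where it is infinite,
    which turns out to be a null set, \<open>Z\<close> takes the default value 0.\<close>
  define S where "S \<omega> = (SUP j. ennreal (2 ^ j * \<bar>D (r j) \<omega>\<bar>))" for \<omega>
  define Z where "Z \<omega> = enn2real (S \<omega>)" for \<omega>
  have [measurable]: "D n \<in> borel_measurable M" for n using D Orlicz_heartD by blast
  have [measurable]: "S \<in> borel_measurable M" unfolding S_def by measurable
  have Z[measurable]: "Z \<in> borel_measurable M" unfolding Z_def by measurable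
  have "(\<integral>\<^sup>+\<omega>. (\<Sum>j. ennreal (\<Psi> (c * 2 ^ j * \<bar>D (r j) \<omega>\<bar>))) \<partial>M) < \<infinity>" if c: "0 \<le> c" for c
  proof -
    let ?I = "\<lambda>j. \<integral>\<omega>. \<Psi> ((c * 2 ^ j) * \<bar>D (r j) \<omega>\<bar>) \<partial>M"
    have I0: "0 \<le> ?I j" for j using c by (intro Bochner_Integration.integral_nonneg Young_nonneg) auto
    obtain N where N: "c < 2 ^ N" using real_arch_pow[of 2 c] by force
    have "?I j \<le> (1/2) ^ j" if "N \<le> j" for j
    proof -
      have "c \<le> 2 ^ j" using N power_increasing[OF that, of "2::real"] by linarith
      then have "c * 2 ^ j \<le> 2 ^ j * 2 ^ j" by (intro mult_right_mono) auto
      also have "\<dots> = 4 ^ j" by (simp add: power_mult_distrib[symmetric])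
      finally have "?I j \<le> (\<integral>\<omega>. \<Psi> (4 ^ j * \<bar>D (r j) \<omega>\<bar>) \<partial>M)"
        using c by (intro integral_mono Orlicz_heartD(2)[OF D] Young_mono mult_right_mono) auto
      then show ?thesis using r[of j] by simp
    qed
    then have "summable ?I"
      using I0 by (intro summable_comparison_test_ev[OF _ summable_geometric[of "1/2::real"]])
        (auto simp: eventually_sequentially abs_of_nonneg intro!: exI[of _ N])
    then have "(\<Sum>j. ennreal (?I j)) < \<infinity>" using I0 by (subst suminf_ennreal2) auto
    moreover have "(\<integral>\<^sup>+\<omega>. (\<Sum>j. ennreal (\<Psi> (c * 2 ^ j * \<bar>D (r j) \<omega>\<bar>))) \<partial>M) =
        (\<Sum>j. \<integral>\<^sup>+\<omega>. ennreal (\<Psi> (c * 2 ^ j * \<bar>D (r j) \<omega>\<bar>)) \<partial>M)"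
      using c by (intro nn_integral_suminf measurable_compose[OF measurable_Young_abs measurable_ennreal]) auto
    moreover have "(\<integral>\<^sup>+\<omega>. ennreal (\<Psi> (c * 2 ^ j * \<bar>D (r j) \<omega>\<bar>)) \<partial>M) = ennreal (?I j)" for j
      using c Young_nonneg by (intro nn_integral_eq_integral Orlicz_heartD(2)[OF D]) auto
    ultimately show ?thesis by simp
  qed note fin = this
  have "AE \<omega> in M. (\<Sum>j. ennreal (\<Psi> (1 * 2 ^ j * \<bar>D (r j) \<omega>\<bar>))) \<noteq> \<infinity>"
  proof (rule nn_integral_noteq_infinite)
    show "(\<lambda>\<omega>. \<Sum>j. ennreal (\<Psi> (1 * 2 ^ j * \<bar>D (r j) \<omega>\<bar>))) \<in> borel_measurable M"
      by (intro borel_measurable_suminf_order measurable_compose[OF measurable_Young_abs measurable_ennreal]) auto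
  qed (use fin[of 1] in simp)
  \<comment> \<open>A finite sum bounds all its terms, and since \<open>\<Psi>\<close> tends to
    infinity, bounded values force bounded arguments.\<close>
  then have S_fin: "AE \<omega> in M. S \<omega> < \<infinity>"
  proof eventually_elim
    case (elim \<omega>)
    define T where "T = (\<Sum>j. ennreal (\<Psi> (2 ^ j * \<bar>D (r j) \<omega>\<bar>)))"
    have T: "T < \<infinity>" using elim by (simp add: T_def less_top[symmetric])
    have "filterlim \<Psi> at_top at_top" using young by (auto simp: finite_Young_function_def)
    then have "\<forall>\<^sub>F x in at_top. enn2real T < \<Psi> x" by (simp add: filterlim_at_top_dense)
    then obtain x0 where x0: "\<And>x. x0 \<le> x \<Longrightarrow> enn2real T < \<Psi> x" by (auto simp: eventually_at_top_linorder)
    have "2 ^ j * \<bar>D (r j) \<omega>\<bar> \<le> x0" for j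
    proof (rule ccontr)
      assume "\<not> ?thesis"
      then have "ennreal (enn2real T) < ennreal (\<Psi> (2 ^ j * \<bar>D (r j) \<omega>\<bar>))"
        using x0[of "2 ^ j * \<bar>D (r j) \<omega>\<bar>"] by (simp add: ennreal_less_iff)
      moreover have "ennreal (\<Psi> (2 ^ j * \<bar>D (r j) \<omega>\<bar>)) \<le> T"
        unfolding T_def by (rule le_suminf_ennreal)
      ultimately show False using T by simp
    qed
    then have "S \<omega> \<le> ennreal x0" unfolding S_def by (intro SUP_least ennreal_leI)
    then show ?case by (rule le_less_trans) simp
  qed
  have Z0: "0 \<le> Z \<omega>" for \<omega> by (simp add: Z_def)
  have le_Z: "2 ^ j * \<bar>D (r j) \<omega>\<bar> \<le> Z \<omega>" if "S \<omega> < \<infinity>" for j \<omega>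
  proof -
    have "ennreal (2 ^ j * \<bar>D (r j) \<omega>\<bar>) \<le> S \<omega>" unfolding S_def by (rule SUP_upper) simp
    also have "S \<omega> = ennreal (Z \<omega>)" using that by (simp add: Z_def)
    finally show ?thesis using Z0 by (simp add: ennreal_le_iff)
  qed
  have "Z \<in> Orlicz_heart \<Psi> M"
    unfolding Orlicz_heart_def
  proof (intro CollectI conjI allI impI)
    fix c :: real assume c: "0 < c"
    \<comment> \<open>The supremum need not be attained, but if \<open>Z\<close> is positive, some
      term exceeds half of it; hence the factor 2.\<close>
    have "AE \<omega> in M. ennreal (\<Psi> (c * \<bar>Z \<omega>\<bar>)) \<le> (\<Sum>j. ennreal (\<Psi> (2 * c * 2 ^ j * \<bar>D (r j) \<omega>\<bar>)))"
      using S_fin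
    proof eventually_elim
      case (elim \<omega>)
      show ?case
      proof (cases "Z \<omega> = 0")
        case True
        then show ?thesis using young by (simp add: finite_Young_function_def)
      next
        case False
        then have "ennreal (Z \<omega> / 2) < ennreal (Z \<omega>)"
          using Z0[of \<omega>] by (simp add: ennreal_less_iff)
        also have "\<dots> = S \<omega>" using elim by (simp add: Z_def)
        finally obtain j where "ennreal (Z \<omega> / 2) < ennreal (2 ^ j * \<bar>D (r j) \<omega>\<bar>)"
          unfolding S_def less_SUP_iff by auto
        then have "Z \<omega> / 2 < 2 ^ j * \<bar>D (r j) \<omega>\<bar>" using Z0 by (simp add: ennreal_less_iff)
        then have "c * \<bar>Z \<omega>\<bar> \<le> c * (2 * (2 ^ j * \<bar>D (r j) \<omega>\<bar>))"
          using c Z0[of \<omega>] by (intro mult_left_mono) linarith+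
        also have "\<dots> = 2 * c * 2 ^ j * \<bar>D (r j) \<omega>\<bar>" by (simp only: mult_ac)
        finally have "c * \<bar>Z \<omega>\<bar> \<le> 2 * c * 2 ^ j * \<bar>D (r j) \<omega>\<bar>" .
        then have "\<Psi> (c * \<bar>Z \<omega>\<bar>) \<le> \<Psi> (2 * c * 2 ^ j * \<bar>D (r j) \<omega>\<bar>)"
          using c by (intro Young_mono) auto
        then have "ennreal (\<Psi> (c * \<bar>Z \<omega>\<bar>)) \<le> ennreal (\<Psi> (2 * c * 2 ^ j * \<bar>D (r j) \<omega>\<bar>))"
          by (rule ennreal_leI)
        also have "\<dots> \<le> (\<Sum>j. ennreal (\<Psi> (2 * c * 2 ^ j * \<bar>D (r j) \<omega>\<bar>)))"
          by (rule le_suminf_ennreal)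
        finally show ?thesis .
      qed
    qed
    then have "(\<integral>\<^sup>+\<omega>. ennreal (\<Psi> (c * \<bar>Z \<omega>\<bar>)) \<partial>M) \<le>
        (\<integral>\<^sup>+\<omega>. (\<Sum>j. ennreal (\<Psi> (2 * c * 2 ^ j * \<bar>D (r j) \<omega>\<bar>))) \<partial>M)"
      by (rule nn_integral_mono_AE)
    also have "\<dots> < \<infinity>" using c by (intro fin) simp
    finally show "(\<integral>\<^sup>+\<omega>. ennreal (\<Psi> (c * \<bar>Z \<omega>\<bar>)) \<partial>M) < \<infinity>" .
  qed fact
  moreover have "AE \<omega> in M. \<forall>j. \<bar>D (r j) \<omega>\<bar> \<le> (1/2) ^ j * Z \<omega>"
    using S_fin
  proof eventually_elim
    case (elim \<omega>)
    show ?case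
    proof
      fix j
      show "\<bar>D (r j) \<omega>\<bar> \<le> (1/2) ^ j * Z \<omega>"
        using le_Z[OF elim, of j] by (simp add: power_one_over field_simps)
    qed
  qed
  ultimately show ?thesis using that by blast
qed

text \<open>The lower bound writes \<open>X\<close> as a convex combination of \<open>X + t Z\<close> and \<open>X - Z\<close>.\<close>

lemma convex_antitone_close:
  assumes \<rho>: "law_invariant_convex_risk_measure M (Orlicz_heart \<Psi> M) \<rho>"
    and X: "X \<in> Orlicz_heart \<Psi> M" and Y: "Y \<in> Orlicz_heart \<Psi> M" and Z: "Z \<in> Orlicz_heart \<Psi> M"
    and t: "0 \<le> t" "t \<le> 1" and close: "AE \<omega> in M. \<bar>Y \<omega> - X \<omega>\<bar> \<le> t * Z \<omega>"
  shows "\<bar>\<rho> Y - \<rho> X\<bar> \<le> t * (\<rho> (\<lambda>\<omega>. X \<omega> - Z \<omega>) - \<rho> X)"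
proof -
  have H: "(\<lambda>\<omega>. X \<omega> + a * Z \<omega>) \<in> Orlicz_heart \<Psi> M" for a by (rule Orlicz_heart_add_scaled[OF X Z])
  have anti: "\<rho> A \<ge> \<rho> B" if "A \<in> Orlicz_heart \<Psi> M" "B \<in> Orlicz_heart \<Psi> M" "AE \<omega> in M. A \<omega> \<le> B \<omega>" for A B
    using \<rho> that unfolding law_invariant_convex_risk_measure_def by blast
  have conv: "\<rho> (\<lambda>\<omega>. s * A \<omega> + (1 - s) * B \<omega>) \<le> s * \<rho> A + (1 - s) * \<rho> B"
    if "A \<in> Orlicz_heart \<Psi> M" "B \<in> Orlicz_heart \<Psi> M" "0 \<le> s" "s \<le> 1" for A B s
    using \<rho> that unfolding law_invariant_convex_risk_measure_def by (metis atLeastAtMost_iff)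
  let ?XZ = "\<lambda>\<omega>. X \<omega> + (- 1) * Z \<omega>"
  have "\<rho> Y \<le> \<rho> (\<lambda>\<omega>. X \<omega> + (- t) * Z \<omega>)"
    by (rule anti[OF H Y]) (use close in eventually_elim, auto)
  \<comment> \<open>For the upper bound, \<open>X - t Z\<close> lies on the segment from
    \<open>X\<close> to \<open>X - Z\<close>.\<close>
  also have "(\<lambda>\<omega>. X \<omega> + (- t) * Z \<omega>) = (\<lambda>\<omega>. t * ?XZ \<omega> + (1 - t) * X \<omega>)" by (auto simp: algebra_simps)
  also have "\<rho> \<dots> \<le> t * \<rho> ?XZ + (1 - t) * \<rho> X" by (rule conv[OF H X t])
  finally have upper: "\<rho> Y - \<rho> X \<le> t * (\<rho> ?XZ - \<rho> X)" by (simp add: algebra_simps)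
  \<comment> \<open>This weight satisfies \<open>s * t = 1 - s\<close>, so the contributions of
    \<open>Z\<close> cancel.\<close>
  define s where "s = 1 / (1 + t)"
  have s: "1 - s = t * s" "(1 + t) * s = 1" "0 \<le> s" "s \<le> 1" using t by (auto simp: s_def field_simps)
  have "X = (\<lambda>\<omega>. s * (X \<omega> + t * Z \<omega>) + (1 - s) * ?XZ \<omega>)"
  proof
    fix \<omega>
    have "s * (X \<omega> + t * Z \<omega>) + (1 - s) * ?XZ \<omega> = (1 + t) * s * X \<omega>"
      unfolding s(1) by (simp add: algebra_simps)
    then show "X \<omega> = s * (X \<omega> + t * Z \<omega>) + (1 - s) * ?XZ \<omega>" unfolding s(2) by simp
  qed
  then have "\<rho> X \<le> s * \<rho> (\<lambda>\<omega>. X \<omega> + t * Z \<omega>) + (1 - s) * \<rho> ?XZ"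
    using conv[OF H[of t] H[of "- 1"] s(3,4)] by simp
  then have "(1 + t) * \<rho> X \<le> (1 + t) * (s * \<rho> (\<lambda>\<omega>. X \<omega> + t * Z \<omega>) + (1 - s) * \<rho> ?XZ)"
    using t by (intro mult_left_mono) auto
  also have "\<dots> = ((1 + t) * s) * \<rho> (\<lambda>\<omega>. X \<omega> + t * Z \<omega>) + t * (((1 + t) * s) * \<rho> ?XZ)"
    unfolding s(1) by (simp only: algebra_simps)
  also have "\<dots> = \<rho> (\<lambda>\<omega>. X \<omega> + t * Z \<omega>) + t * \<rho> ?XZ" unfolding s(2) by simp
  also have "\<rho> (\<lambda>\<omega>. X \<omega> + t * Z \<omega>) \<le> \<rho> Y"
    by (rule anti[OF Y H]) (use close in eventually_elim, auto)
  finally have "\<rho> X - \<rho> Y \<le> t * (\<rho> ?XZ - \<rho> X)" by (simp add: algebra_simps)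
  then show ?thesis using upper by simp
qed

end

subsection \<open>Continuity of the risk functional\<close>

text \<open>Countably many test functions yield a decreasing sequence of open neighbourhoods. If all
  of them failed, points chosen from them would converge on \<open>F\<close> while their values
  stayed outside \<open>V\<close>. A single good index therefore suffices as conclusion of
  \<open>seq\<close>.\<close>

lemma continuous_map_gauged_weakI:
  fixes R :: "real measure \<Rightarrow> real"
  assumes F: "countable F" "F \<noteq> {}" "F \<subseteq> gauged_test_functions \<psi>"
    and seq: "\<And>\<nu> \<mu> e. (\<And>n::nat. \<nu> n \<in> prob_measures_gauged \<psi>) \<Longrightarrow> \<mu> \<in> prob_measures_gauged \<psi> \<Longrightarrow>
      (\<And>f. f \<in> F \<Longrightarrow> (\<lambda>n. integral\<^sup>L (\<nu> n) f) \<longlonglongrightarrow> integral\<^sup>L \<mu> f) \<Longrightarrow> 0 < e \<Longrightarrow>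
      \<exists>n. \<bar>R (\<nu> n) - R \<mu>\<bar> < e"
  shows "continuous_map (gauged_weak_topology \<psi>) euclideanreal R"
  unfolding continuous_map_eq_topcontinuous_at topcontinuous_at_def topspace_gauged_weak_topology
proof (intro ballI conjI allI impI)
  fix \<mu> V assume \<mu>: "\<mu> \<in> prob_measures_gauged \<psi>" and "openin euclideanreal V \<and> R \<mu> \<in> V"
  then obtain e where e: "0 < e" "ball (R \<mu>) e \<subseteq> V" by (auto simp: open_contains_ball)
  \<comment> \<open>The number of constraints and their precision grow together, so beyond
    \<open>max j m\<close> the \<open>j\<close>-th integral is within
    \<open>1 / real (Suc m)\<close> of its limit.\<close>
  define N where "N n = (\<Inter>j\<le>n. {\<nu> \<in> prob_measures_gauged \<psi>.
    (\<integral>x. from_nat_into F j x \<partial>\<nu>) \<in> ball (\<integral>x. from_nat_into F j x \<partial>\<mu>) (1 / real (Suc n))})" for n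
  have N_open: "openin (gauged_weak_topology \<psi>) (N n)" for n
    unfolding N_def gauged_weak_topology_def
  proof (intro openin_INT2 topology_generated_by_Basis)
    fix j
    show "{\<nu> \<in> prob_measures_gauged \<psi>.
        (\<integral>x. from_nat_into F j x \<partial>\<nu>) \<in> ball (\<integral>x. from_nat_into F j x \<partial>\<mu>) (1 / real (Suc n))}
      \<in> {{\<mu> \<in> prob_measures_gauged \<psi>. (\<integral>x. f x \<partial>\<mu>) \<in> U} | f U. f \<in> gauged_test_functions \<psi> \<and> open U}"
      using F(3) from_nat_into[OF F(2), of j] by blast
  qed auto
  have "\<exists>n. \<forall>\<nu>\<in>N n. R \<nu> \<in> V"
  proof (rule ccontr)
    assume "\<not> ?thesis"
    then obtain \<nu> where \<nu>: "\<And>n. \<nu> n \<in> N n" "\<And>n. R (\<nu> n) \<notin> V" by metis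
    have "(\<lambda>n. integral\<^sup>L (\<nu> n) f) \<longlonglongrightarrow> integral\<^sup>L \<mu> f" if f: "f \<in> F" for f
    proof -
      obtain j where j: "f = from_nat_into F j" using from_nat_into_surj[OF F(1) f] by metis
      show ?thesis
      proof (rule LIMSEQ_I)
        fix d :: real assume "0 < d"
        then obtain m where m: "1 / real (Suc m) < d" using nat_approx_posE by blast
        have "norm (integral\<^sup>L (\<nu> n) f - integral\<^sup>L \<mu> f) < d" if n: "max j m \<le> n" for n
        proof -
          have "dist (integral\<^sup>L \<mu> f) (integral\<^sup>L (\<nu> n) f) < 1 / real (Suc n)"
            using \<nu>(1)[of n] n by (auto simp: N_def j)
          also have "\<dots> \<le> 1 / real (Suc m)" using n by (intro divide_left_mono) auto
          finally show ?thesis using m by (simp add: dist_norm norm_minus_commute)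
        qed
        then show "\<exists>n0. \<forall>n\<ge>n0. norm (integral\<^sup>L (\<nu> n) f - integral\<^sup>L \<mu> f) < d" by blast
      qed
    qed
    moreover have "\<nu> n \<in> prob_measures_gauged \<psi>" for n using \<nu>(1)[of n] by (auto simp: N_def)
    ultimately obtain n where "\<bar>R (\<nu> n) - R \<mu>\<bar> < e" using seq[of \<nu> \<mu> e] \<mu> e(1) by blast
    then have "R (\<nu> n) \<in> ball (R \<mu>) e" by (simp add: dist_real_def abs_minus_commute)
    then show False using e(2) \<nu>(2)[of n] by blast
  qed
  moreover have "\<mu> \<in> N n" for n using \<mu> by (auto simp: N_def)
  ultimately show "\<exists>U. openin (gauged_weak_topology \<psi>) U \<and> \<mu> \<in> U \<and> (\<forall>y\<in>U. R y \<in> V)"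
    using N_open by blast
qed auto

theorem theorem4p16:
  fixes \<Psi> :: "real \<Rightarrow> real" and M :: "'a measure"
    and \<rho> :: "('a \<Rightarrow> real) \<Rightarrow> real" and R :: "real measure \<Rightarrow> real"
  assumes "finite_Young_function \<Psi>"
    and "prob_space M" and "atomless M"
    and "law_invariant_convex_risk_measure M (Orlicz_heart \<Psi> M) \<rho>"
    and "\<forall>X\<in>Orlicz_heart \<Psi> M. \<rho> X = R (distr M borel X)"
  shows "continuous_map (gauged_weak_topology (gauge_seq \<Psi>)) euclideanreal R"
proof -
  interpret prob_space M by fact
  note young = assms(1)
  let ?P = "prob_measures_gauged (gauge_seq \<Psi>)"
  obtain U where U: "U \<in> borel_measurable M" "\<And>\<omega>. 0 < U \<omega> \<and> U \<omega> < 1"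
      "\<And>x. x \<in> {0..1} \<Longrightarrow> prob {\<omega>\<in>space M. U \<omega> \<le> x} = x"
    using atomless_uniform[OF assms(3)] by blast
  \<comment> \<open>All laws are coupled through the same \<open>U\<close>, so convergence of laws
    can become almost sure convergence.\<close>
  define X where "X \<mu> = (\<lambda>\<omega>. quantile \<mu> (U \<omega>))" for \<mu>
  have gauge_meas[measurable]: "gauge_seq \<Psi> k \<in> borel_measurable borel" for k
    unfolding gauge_seq_def[abs_def] by (rule measurable_Young_abs[OF young]) auto
  have rd: "real_distribution \<mu>" if "\<mu> \<in> ?P" for \<mu>
    using that by (auto simp: prob_measures_gauged_def real_distribution_def real_distribution_axioms_def)
  have X_meas[measurable]: "X \<mu> \<in> borel_measurable M" and X_distr: "distr M borel (X \<mu>) = \<mu>" if "\<mu> \<in> ?P" for \<mu>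
    unfolding X_def using distr_quantile[OF U rd[OF that]] by auto
  have X_heart: "X \<mu> \<in> Orlicz_heart \<Psi> M" if "\<mu> \<in> ?P" for \<mu>
  proof (rule Orlicz_heartI[OF young X_meas[OF that]])
    fix k :: nat
    have "(\<integral>\<^sup>+\<omega>. ennreal (\<Psi> (real k * \<bar>X \<mu> \<omega>\<bar>)) \<partial>M) = (\<integral>\<^sup>+x. ennreal (gauge_seq \<Psi> k x) \<partial>distr M borel (X \<mu>))"
      unfolding gauge_seq_def[symmetric] using X_meas[OF that] by (subst nn_integral_distr) auto
    also have "\<dots> < \<infinity>" using that X_distr[OF that] by (simp add: prob_measures_gauged_def)
    finally show "(\<integral>\<^sup>+\<omega>. ennreal (\<Psi> (real k * \<bar>X \<mu> \<omega>\<bar>)) \<partial>M) < \<infinity>" .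
  qed
  have X_integral: "(\<integral>\<omega>. \<Psi> (real k * \<bar>X \<mu> \<omega>\<bar>) \<partial>M) = integral\<^sup>L \<mu> (gauge_seq \<Psi> k)" if "\<mu> \<in> ?P" for \<mu> k
    using integral_distr[OF X_meas[OF that] gauge_meas[of k]] X_distr[OF that] by (simp add: gauge_seq_def)
  have R_eq: "R \<mu> = \<rho> (X \<mu>)" if "\<mu> \<in> ?P" for \<mu>
    using assms(5) X_heart[OF that] X_distr[OF that] by simp
  \<comment> \<open>The steps control the quantiles, and the gauges control the integrals entering
    the Fatou argument.\<close>
  define F where "F = range (gauge_seq \<Psi>) \<union> (\<lambda>(q, r). cts_step q r) ` {(q, r) \<in> \<rat> \<times> \<rat>. q < r}"
  show ?thesis
  proof (rule continuous_map_gauged_weakI)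
    show "countable F"
      unfolding F_def
      by (intro countable_Un countable_image countable_subset[OF _ countable_SIGMA[OF countable_rat countable_rat]]) auto
    show "F \<noteq> {}" by (auto simp: F_def)
    have gauge0: "0 \<le> gauge_seq \<Psi> k x" for k x by (simp add: gauge_seq_def Young_nonneg[OF young])
    have "gauge_seq \<Psi> k \<in> gauged_test_functions (gauge_seq \<Psi>)" for k
      unfolding gauged_test_functions_def
    proof (intro CollectI conjI exI[of _ k])
      show "continuous_on UNIV (gauge_seq \<Psi> k)"
        unfolding gauge_seq_def[abs_def] by (rule continuous_on_Young_abs[OF young]) simp
      show "bdd_above (range (\<lambda>x. \<bar>gauge_seq \<Psi> k x / (1 + gauge_seq \<Psi> k x)\<bar>))"
      proof (rule bdd_aboveI2)
        show "\<bar>gauge_seq \<Psi> k x / (1 + gauge_seq \<Psi> k x)\<bar> \<le> 1" for x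
          using gauge0[of k x] by simp
      qed
    qed
    moreover have "cts_step q r \<in> gauged_test_functions (gauge_seq \<Psi>)" if "q < r" for q r
      unfolding gauged_test_functions_def
    \<comment> \<open>The gauge with index 0 vanishes, so for a bounded function the weight is
      1.\<close>
    proof (intro CollectI conjI exI[of _ 0])
      show "continuous_on UNIV (cts_step q r)"
        using cts_step_uniformly_continuous[OF that] by (rule uniformly_continuous_imp_continuous)
      have "gauge_seq \<Psi> 0 x = 0" for x using young by (simp add: gauge_seq_def finite_Young_function_def)
      then show "bdd_above (range (\<lambda>x. \<bar>cts_step q r x / (1 + gauge_seq \<Psi> 0 x)\<bar>))"
        using that by (intro bdd_aboveI[of _ 1]) (auto simp: cts_step_def)
    qed
    ultimately show "F \<subseteq> gauged_test_functions (gauge_seq \<Psi>)" by (auto simp: F_def)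
  next
    fix \<nu> :: "nat \<Rightarrow> real measure" and \<mu> and e :: real
    assume \<nu>: "\<And>n. \<nu> n \<in> ?P" and \<mu>: "\<mu> \<in> ?P" and "0 < e"
      and conv: "\<And>f. f \<in> F \<Longrightarrow> (\<lambda>n. integral\<^sup>L (\<nu> n) f) \<longlonglongrightarrow> integral\<^sup>L \<mu> f"
    have "(\<lambda>n. integral\<^sup>L (\<nu> n) (cts_step q r)) \<longlonglongrightarrow> integral\<^sup>L \<mu> (cts_step q r)"
      if "q \<in> \<rat>" "r \<in> \<rat>" "q < r" for q r
      by (rule conv) (use that in \<open>auto simp: F_def\<close>)
    then have "AE \<omega> in M. (\<lambda>n. X (\<nu> n) \<omega>) \<longlonglongrightarrow> X \<mu> \<omega>"
      unfolding X_def by (intro AE_quantile_tendsto[OF U rd[OF \<nu>] rd[OF \<mu>]]) auto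
    moreover have "(\<lambda>n. \<integral>\<omega>. \<Psi> (real k * \<bar>X (\<nu> n) \<omega>\<bar>) \<partial>M) \<longlonglongrightarrow> (\<integral>\<omega>. \<Psi> (real k * \<bar>X \<mu> \<omega>\<bar>) \<partial>M)" for k
      unfolding X_integral[OF \<nu>] X_integral[OF \<mu>] by (rule conv) (auto simp: F_def)
    ultimately have "(\<lambda>n. \<integral>\<omega>. \<Psi> (real k * \<bar>X (\<nu> n) \<omega> - X \<mu> \<omega>\<bar>) \<partial>M) \<longlonglongrightarrow> 0" for k
      by (rule Young_difference_integral_tendsto_0[OF young X_heart[OF \<nu>] X_heart[OF \<mu>]])
    moreover have "(\<lambda>\<omega>. X (\<nu> n) \<omega> - X \<mu> \<omega>) \<in> Orlicz_heart \<Psi> M" for n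
      using Orlicz_heart_add_scaled[OF young X_heart[OF \<nu>] X_heart[OF \<mu>], of n "- 1"] by simp
    ultimately obtain r :: "nat \<Rightarrow> nat" and Z where Z: "Z \<in> Orlicz_heart \<Psi> M"
      "AE \<omega> in M. \<forall>j. \<bar>X (\<nu> (r j)) \<omega> - X \<mu> \<omega>\<bar> \<le> (1/2) ^ j * Z \<omega>"
      using Orlicz_heart_fast_dominated[OF young, of "\<lambda>n \<omega>. X (\<nu> n) \<omega> - X \<mu> \<omega>" M] by blast
    let ?K = "\<rho> (\<lambda>\<omega>. X \<mu> \<omega> - Z \<omega>) - \<rho> (X \<mu>)"
    \<comment> \<open>The constant \<open>?K\<close> does not depend on \<open>j\<close>, because
      one variable \<open>Z\<close> dominates all the selected differences.\<close>
    have "\<bar>R (\<nu> (r j)) - R \<mu>\<bar> \<le> (1/2) ^ j * ?K" for j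
      unfolding R_eq[OF \<nu>] R_eq[OF \<mu>]
      by (rule convex_antitone_close[OF young assms(4) X_heart[OF \<mu>] X_heart[OF \<nu>] Z(1)])
        (use Z(2) in \<open>auto simp: power_le_one elim: eventually_mono\<close>)
    moreover have "\<exists>j. (1/2) ^ j * ?K < e"
    proof -
      have "(\<lambda>j. (1/2) ^ j * ?K) \<longlonglongrightarrow> 0 * ?K" by (intro tendsto_intros) auto
      then have "\<forall>\<^sub>F j in sequentially. (1/2) ^ j * ?K < e" using \<open>0 < e\<close> by (intro order_tendstoD) auto
      then show ?thesis using eventually_happens'[OF sequentially_bot] by blast
    qed
    ultimately show "\<exists>n. \<bar>R (\<nu> n) - R \<mu>\<bar> < e" by (meson le_less_trans)
  qed
qed

end
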